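(* Let $V$ and $W$ be Banach spaces, and assume that the tensor powers of $V$ are all equipped with admissible norms. Assume that $\Sigma \subset V$ is compact. Let $\varepsilon > 0$, $(K_1,K_2) \in (\mathbb{R}_{\geq 0} \times \mathbb{R}_{\geq 0}) \setminus \{(0,0)\}$, and $\gamma > \eta > 0$ with $k,q \in \mathbb{Z}_{\geq 0}$ such that $\gamma \in (k,k+1]$ and $\eta \in (q,q+1]$. Let $\delta_0 = \delta_0(\varepsilon,K_1+K_2,\gamma,\eta) > 0$ and $\varepsilon_0 = \varepsilon_0(\varepsilon,K_1+K_2,\gamma,\eta) > 0$ denote the Lipschitz sandwich constants (described in the context), and let $N = N(\Sigma,\varepsilon,K_1+K_2,\gamma,\eta) \in \mathbb{Z}_{\geq 0}$ denote the $\delta_0$-covering number of $\Sigma$, that is, $$N := \min\left\{ d \in \mathbb{Z}_{\geq 0} : \text{there exist } x_1,\ldots,x_d \in \Sigma \text{ such that } \Sigma \subset \bigcup_{j=1}^d \overline{\mathbb{B}}_V(x_j,\delta_0) \right\}.$$ Then there is a finite subset $\Sigma_N = \{z_1,\ldots,z_N\} \subset \Sigma$ for which the following is true. Suppose $\psi = (\psi^{(0)},\ldots,\psi^{(k)})$ and $\varphi = (\varphi^{(0)},\ldots,\varphi^{(k)})$ in $\mathrm{Lip}(\gamma,\Sigma,W)$ satisfy $\|\psi\|_{\mathrm{Lip}(\gamma,\Sigma,W)} \leq K_1$ and $\|\varphi\|_{\mathrm{Lip}(\gamma,\Sigma,W)} \leq K_2$. Further suppose that for every $l \in \{0,\ldots,k\}$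 and every $j \in \{1,\ldots,N\}$ we have $$\left\| \psi^{(l)}(z_j) - \varphi^{(l)}(z_j) \right\|_{\mathcal{L}(V^{\otimes l};W)} \leq \varepsilon_0.$$ Then $$\left\| \psi_{[q]} - \varphi_{[q]} \right\|_{\mathrm{Lip}(\eta,\Sigma,W)} \leq \varepsilon,$$ where $\psi_{[q]} := (\psi^{(0)},\ldots,\psi^{(q)})$ and $\varphi_{[q]} := (\varphi^{(0)},\ldots,\varphi^{(q)})$.
   Context: All Banach spaces are real. $\overline{\mathbb{B}}_V(x,r) := \{v \in V : \|v-x\|_V \leq r\}$. Admissible norms: the tensor powers of $V$ are equipped with admissible norms if for each $n \in \mathbb{Z}_{\geq 2}$ the tensor power $V^{\otimes n}$ carries a norm $\|\cdot\|_{V^{\otimes n}}$ (with $V^{\otimes 1} = V$ carrying its own norm) such that: (i) for each $n \geq 1$ the symmetric group $S_n$ acts by isometries on $V^{\otimes n}$, the action being $\rho(a_1 \otimes \cdots \otimes a_n) := a_{\rho(1)} \otimes \cdots \otimes a_{\rho(n)}$ extended linearly; (ii) for all $n,m \geq 1$, $v \in V^{\otimes n}$, $w \in V^{\otimes m}$: $\|v \otimes w\|_{V^{\otimes(n+m)}} \leq \|v\|_{V^{\otimes n}} \|w\|_{V^{\otimes m}}$; (iii) for all $n,m \geq 1$, $\phi \in (V^{\otimes n})^*$, $\sigma \in (V^{\otimes m})^*$: $\|\phi \otimes \sigma\|_{(V^{\otimes (n+m)})^*} \leq \|\phi\|_{(V^{\otimes n})^*} \|\sigma\|_{(V^{\otimes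 m})^*}$, with dual norms. (Having both (ii) and (iii) forces equality in both.) $\mathcal{L}(V^{\otimes l};W)$ is the space of symmetric $l$-linear forms from $V$ to $W$, regarded as a subspace of the linear maps $V^{\otimes l} \to W$, with the operator norm $\|\mathbf{A}\|_{\mathcal{L}(V^{\otimes l};W)} = \sup\{\|\mathbf{A}[v]\|_W : \|v\|_{V^{\otimes l}} = 1\}$. $V^{\otimes 0} := \mathbb{R}$ and $\mathcal{L}(V^{\otimes 0};W) = W$ with norm $\|\cdot\|_W$. $\mathrm{Lip}(\gamma,\Sigma,W)$: let $\Sigma \subset V$ be closed, $\gamma > 0$ and $k \in \mathbb{Z}_{\geq 0}$ with $\gamma \in (k,k+1]$. A collection $\psi = (\psi^{(0)},\ldots,\psi^{(k)})$ of functions $\psi^{(l)} : \Sigma \to \mathcal{L}(V^{\otimes l};W)$ is in $\mathrm{Lip}(\gamma,\Sigma,W)$ if there is $M \geq 0$ such that for all $l \in \{0,\ldots,k\}$ and $x,y \in \Sigma$: (a) $\|\psi^{(l)}(x)\|_{\mathcal{L}(V^{\otimes l};W)} \leq M$; (b) $\|R^\psi_l(x,y)\|_{\mathcal{L}(V^{\otimes l};W)} \leq M\|y-x\|_V^{\gamma-l}$, where for $v \in V^{\otimes l}$ $$R^\psi_l(x,y)[v] := \psi^{(l)}(y)[v] - \sum_{s=0}^{k-l} \frac{1}{s!} \psi^{(l+s)}(x)\left[v \otimes (y-x)^{\otimes s}\right].$$ The norm $\|\psi\|_{\mathrm{Lip}(\gamma,\Sigma,W)}$ is the smallest such $M$.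 Differences are taken componentwise. Lipschitz sandwich constants: the paper's Lipschitz Sandwich Theorem provides constants $\delta_0,\varepsilon_0 > 0$, depending only on $\varepsilon$, $K_1+K_2$, $\gamma$, $\eta$, with the following property for every non-empty closed $\Sigma \subset V$. If $B \subset \Sigma$ is closed with $\Sigma \subset \bigcup_{x \in B} \overline{\mathbb{B}}_V(x,\delta_0)$, and $\psi,\varphi \in \mathrm{Lip}(\gamma,\Sigma,W)$ satisfy $\|\psi\|_{\mathrm{Lip}(\gamma,\Sigma,W)} \leq K_1$, $\|\varphi\|_{\mathrm{Lip}(\gamma,\Sigma,W)} \leq K_2$ and $\|\psi^{(l)}(x)-\varphi^{(l)}(x)\|_{\mathcal{L}(V^{\otimes l};W)} \leq \varepsilon_0$ for all $l \in \{0,\ldots,k\}$ and $x \in B$, then $\|\psi_{[q]}-\varphi_{[q]}\|_{\mathrm{Lip}(\eta,\Sigma,W)} \leq \varepsilon$. The constants $\delta_0,\varepsilon_0$ in the claim are any fixed such constants. *)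

theory Defs
  imports
    "HOL-Analysis.Analysis"
    "HOL-Analysis.Finite_Function_Topology"
    "HOL-Combinatorics.Permutations"
begin

section \<open>Algebraic tensor powers\<close>

text \<open>
  The tensor algebra of \<open>V\<close> is the free real vector space on the words over \<open>V\<close> modulo the
  relations of multilinearity. The word \<open>[a\<^sub>1, \<dots>, a\<^sub>n]\<close> stands for \<open>a\<^sub>1 \<otimes> \<dots> \<otimes> a\<^sub>n\<close>. The relations
  are homogeneous in the length, so that the classes of the words of length \<open>n\<close> span \<open>V\<^bsup>\<otimes>n\<^esup>\<close>;
  in particular \<open>V\<^bsup>\<otimes>0\<^esup>\<close> is the line spanned by the class of the empty word. One type thus houses
  all tensor powers.
\<close>

definition tensor_relators :: "('v::real_vector list \<Rightarrow>\<^sub>0 real) set" where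
  "tensor_relators =
     {Poly_Mapping.single (xs @ (u + v) # ys) 1
        - Poly_Mapping.single (xs @ u # ys) 1 - Poly_Mapping.single (xs @ v # ys) 1
        | xs ys u v. True} \<union>
     {Poly_Mapping.single (xs @ (c *\<^sub>R u) # ys) 1 - c *\<^sub>R Poly_Mapping.single (xs @ u # ys) 1
        | xs ys u c. True}"

quotient_type (overloaded) 'v tensor =
  "'v::real_vector list \<Rightarrow>\<^sub>0 real" / "\<lambda>p q. p - q \<in> span tensor_relators"
proof (rule equivpI)
  show "reflp (\<lambda>p q. p - q \<in> span (tensor_relators :: ('v list \<Rightarrow>\<^sub>0 real) set))"
    by (rule reflpI) (simp add: span_zero)
  show "symp (\<lambda>p q. p - q \<in> span (tensor_relators :: ('v list \<Rightarrow>\<^sub>0 real) set))"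
    by (rule sympI) (metis minus_diff_eq span_neg)
  show "transp (\<lambda>p q. p - q \<in> span (tensor_relators :: ('v list \<Rightarrow>\<^sub>0 real) set))"
    by (rule transpI) (drule (1) span_add, simp)
qed

instantiation tensor :: (real_vector) real_vector
begin

lift_definition zero_tensor :: "'a tensor" is 0 .

lift_definition plus_tensor :: "'a tensor \<Rightarrow> 'a tensor \<Rightarrow> 'a tensor" is "(+)"
  unfolding add_diff_add by (rule span_add)

lift_definition minus_tensor :: "'a tensor \<Rightarrow> 'a tensor \<Rightarrow> 'a tensor" is "(-)"
proof -
  fix p p' q q' :: "'a list \<Rightarrow>\<^sub>0 real"
  assume "p - p' \<in> span tensor_relators" "q - q' \<in> span tensor_relators"
  then have "(p - p') - (q - q') \<in> span tensor_relators"
    by (rule span_diff)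
  then show "p - q - (p' - q') \<in> span tensor_relators"
    by (simp add: algebra_simps)
qed

lift_definition uminus_tensor :: "'a tensor \<Rightarrow> 'a tensor" is "uminus"
  unfolding minus_diff_minus by (rule span_neg)

lift_definition scaleR_tensor :: "real \<Rightarrow> 'a tensor \<Rightarrow> 'a tensor" is "scaleR"
  unfolding scaleR_diff_right[symmetric] by (rule span_scale)

instance
  by standard (transfer; simp add: span_zero algebra_simps)+

end

lift_definition pure_tensor :: "'v::real_vector list \<Rightarrow> 'v tensor"
  is "\<lambda>xs. Poly_Mapping.single xs 1" .

definition tensor_power :: "nat \<Rightarrow> 'v::real_vector tensor set" where
  "tensor_power n = span (pure_tensor ` {xs. length xs = n})"


section \<open>The universal property\<close>

definition multilinear :: "('v::real_vector list \<Rightarrow> 'w::real_vector) \<Rightarrow> bool" where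
  "multilinear f \<longleftrightarrow>
     (\<forall>xs ys u v. f (xs @ (u + v) # ys) = f (xs @ u # ys) + f (xs @ v # ys)) \<and>
     (\<forall>xs ys u c. f (xs @ (c *\<^sub>R u) # ys) = c *\<^sub>R f (xs @ u # ys))"

definition word_extend :: "('v list \<Rightarrow> 'w::real_vector) \<Rightarrow> ('v list \<Rightarrow>\<^sub>0 real) \<Rightarrow> 'w" where
  "word_extend f p = (\<Sum>xs\<in>Poly_Mapping.keys p. Poly_Mapping.lookup p xs *\<^sub>R f xs)"

text \<open>
  The linear extension of \<open>f\<close>. It is independent of the chosen representative, and hence
  meaningful, only for multilinear \<open>f\<close>.
\<close>

definition tensor_lift :: "('v::real_vector list \<Rightarrow> 'w::real_vector) \<Rightarrow> 'v tensor \<Rightarrow> 'w" where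
  "tensor_lift f t = word_extend f (rep_tensor t)"

lemma lookup_scaleR_real:
  "Poly_Mapping.lookup (c *\<^sub>R p) i = c *\<^sub>R (Poly_Mapping.lookup p i :: 'b::real_vector)"
proof -
  have "finite {i. c *\<^sub>R Poly_Mapping.lookup p i \<noteq> 0}"
    by (rule finite_subset[OF _ finite_lookup[of p]]) auto
  then show ?thesis
    by (simp add: scaleR_poly_mapping_def)
qed

lemma word_extend_superset:
  assumes "finite A" "Poly_Mapping.keys p \<subseteq> A"
  shows "word_extend f p = (\<Sum>xs\<in>A. Poly_Mapping.lookup p xs *\<^sub>R f xs)"
  unfolding word_extend_def
  by (rule sum.mono_neutral_left) (use assms in \<open>auto simp: in_keys_iff\<close>)

lemma linear_word_extend: "linear (word_extend f)"
proof (rule linearI)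
  fix p q :: "'a list \<Rightarrow>\<^sub>0 real" and c :: real
  let ?A = "Poly_Mapping.keys p \<union> Poly_Mapping.keys q"
  show "word_extend f (p + q) = word_extend f p + word_extend f q"
    using Poly_Mapping.keys_add[of p q]
    by (simp add: word_extend_superset[of ?A] lookup_add scaleR_add_left sum.distrib)
  have "Poly_Mapping.keys (c *\<^sub>R p) \<subseteq> Poly_Mapping.keys p"
    by (auto simp: in_keys_iff lookup_scaleR_real)
  then show "word_extend f (c *\<^sub>R p) = c *\<^sub>R word_extend f p"
    by (simp add: word_extend_superset[of "Poly_Mapping.keys p"] lookup_scaleR_real
        scaleR_sum_right)
qed

lemma word_extend_single [simp]: "word_extend f (Poly_Mapping.single xs 1) = f xs"
  by (simp add: word_extend_def)

lemma word_extend_relators: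
  assumes "multilinear f" "p \<in> span tensor_relators"
  shows "word_extend f p = 0"
proof -
  have "word_extend f r = 0" if "r \<in> tensor_relators" for r
    using that assms(1) linear_word_extend[of f]
    by (auto simp: tensor_relators_def multilinear_def linear_diff linear_scale)
  then show ?thesis
    using assms(2) linear_eq_0_on_span[OF linear_word_extend] by blast
qed

lemma tensor_lift_abs:
  assumes "multilinear f"
  shows "tensor_lift f (abs_tensor p) = word_extend f p"
proof -
  have "rep_tensor (abs_tensor p) - p \<in> span tensor_relators"
    using Quotient3_tensor by (rule rep_abs_rsp_left) (simp add: span_zero)
  then show ?thesis
    using word_extend_relators[OF assms] linear_diff[OF linear_word_extend]
    by (metis eq_iff_diff_eq_0 tensor_lift_def)
qed

lemma tensor_lift_pure:
  assumes "multilinear f"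
  shows "tensor_lift f (pure_tensor xs) = f xs"
  by (simp add: pure_tensor.abs_eq tensor_lift_abs[OF assms])

lemma linear_tensor_lift:
  assumes "multilinear f"
  shows "linear (tensor_lift f)"
proof (rule linearI)
  fix s t :: "'a tensor" and c :: real
  obtain p where [simp]: "s = abs_tensor p"
    using Quotient3_abs_rep[OF Quotient3_tensor, of s] by metis
  obtain q where [simp]: "t = abs_tensor q"
    using Quotient3_abs_rep[OF Quotient3_tensor, of t] by metis
  show "tensor_lift f (s + t) = tensor_lift f s + tensor_lift f t"
    by (simp add: plus_tensor.abs_eq tensor_lift_abs[OF assms] linear_add[OF linear_word_extend])
  show "tensor_lift f (c *\<^sub>R s) = c *\<^sub>R tensor_lift f s"
    by (simp add: scaleR_tensor.abs_eq tensor_lift_abs[OF assms]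
        linear_scale[OF linear_word_extend])
qed

lemma pure_tensor_add:
  "pure_tensor (xs @ (u + v) # ys) = pure_tensor (xs @ u # ys) + pure_tensor (xs @ v # ys)"
proof -
  have "Poly_Mapping.single (xs @ (u + v) # ys) 1 - Poly_Mapping.single (xs @ u # ys) 1
          - Poly_Mapping.single (xs @ v # ys) 1 \<in> tensor_relators"
    unfolding tensor_relators_def by blast
  from span_base[OF this] show ?thesis
    unfolding pure_tensor.abs_eq plus_tensor.abs_eq by (simp add: tensor.abs_eq_iff diff_diff_eq)
qed

lemma pure_tensor_scaleR:
  "pure_tensor (xs @ (c *\<^sub>R u) # ys) = c *\<^sub>R pure_tensor (xs @ u # ys)"
proof -
  have "Poly_Mapping.single (xs @ (c *\<^sub>R u) # ys) 1 - c *\<^sub>R Poly_Mapping.single (xs @ u # ys) 1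
          \<in> tensor_relators"
    unfolding tensor_relators_def by blast
  from span_base[OF this] show ?thesis
    unfolding pure_tensor.abs_eq scaleR_tensor.abs_eq by (simp add: tensor.abs_eq_iff)
qed

lemma multilinear_pure_tensor: "multilinear pure_tensor"
  by (simp add: multilinear_def pure_tensor_add pure_tensor_scaleR)


section \<open>Operations on tensors\<close>

definition tensor_prod :: "'v::real_vector tensor \<Rightarrow> 'v tensor \<Rightarrow> 'v tensor"
    (infixl \<open>\<otimes>\<^sub>T\<close> 70) where
  "s \<otimes>\<^sub>T t = tensor_lift (\<lambda>xs. tensor_lift (\<lambda>ys. pure_tensor (xs @ ys)) t) s"

text \<open>
  The action of a permutation \<open>\<rho>\<close> of \<open>{..<n}\<close> on \<open>V\<^bsup>\<otimes>n\<^esup>\<close>: the entry of index \<open>i\<close> in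
  \<^term>\<open>permute_list \<rho> xs\<close> is \<^term>\<open>xs ! \<rho> i\<close>. The other tensor powers are sent to \<open>0\<close>.
\<close>

definition tensor_permute :: "nat \<Rightarrow> (nat \<Rightarrow> nat) \<Rightarrow> 'v::real_vector tensor \<Rightarrow> 'v tensor" where
  "tensor_permute n \<rho> =
     tensor_lift (\<lambda>xs. if length xs = n then pure_tensor (permute_list \<rho> xs) else 0)"

text \<open>
  The functional \<open>\<phi> \<otimes> \<sigma>\<close> on \<open>V\<^bsup>\<otimes>(n+m)\<^esup>\<close>, for functionals \<open>\<phi>\<close> on \<open>V\<^bsup>\<otimes>n\<^esup>\<close> and \<open>\<sigma>\<close> on \<open>V\<^bsup>\<otimes>m\<^esup>\<close>.
\<close>

definition functional_prod ::
    "nat \<Rightarrow> nat \<Rightarrow> ('v::real_vector tensor \<Rightarrow> real) \<Rightarrow> ('v tensor \<Rightarrow> real) \<Rightarrow> 'v tensor \<Rightarrow> real" where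
  "functional_prod n m \<phi> \<sigma> =
     tensor_lift (\<lambda>xs. if length xs = n + m
                       then \<phi> (pure_tensor (take n xs)) * \<sigma> (pure_tensor (drop n xs)) else 0)"

text \<open>
  Linear maps on \<open>V\<^bsup>\<otimes>n\<^esup>\<close> are represented by functions on the whole type of tensors, of which only
  the values on \<^term>\<open>tensor_power n\<close> matter.
\<close>

definition linear_on_power ::
    "nat \<Rightarrow> ('v::real_vector tensor \<Rightarrow> 'w::real_vector) \<Rightarrow> bool" where
  "linear_on_power n A \<longleftrightarrow>
     (\<forall>s\<in>tensor_power n. \<forall>t\<in>tensor_power n. A (s + t) = A s + A t) \<and>
     (\<forall>c. \<forall>t\<in>tensor_power n. A (c *\<^sub>R t) = c *\<^sub>R A t)"

lemma multilinear_append_left: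
  "multilinear f \<Longrightarrow> multilinear (\<lambda>ys. f (xs @ ys))"
  unfolding multilinear_def append_assoc[symmetric] by blast

lemma tensor_prod_pure: "pure_tensor xs \<otimes>\<^sub>T pure_tensor ys = pure_tensor (xs @ ys)"
proof -
  note ml = multilinear_append_left[OF multilinear_pure_tensor]
  have "multilinear (\<lambda>xs. tensor_lift (\<lambda>ys. pure_tensor (xs @ ys)) (pure_tensor ys))"
    unfolding tensor_lift_pure[OF ml]
    by (simp add: multilinear_def pure_tensor_add pure_tensor_scaleR)
  then show ?thesis
    by (simp add: tensor_prod_def tensor_lift_pure tensor_lift_pure[OF ml])
qed

lemma multilinear_permute:
  assumes "\<rho> permutes {..<n}"
  shows "multilinear (\<lambda>xs. if length xs = n then pure_tensor (permute_list \<rho> xs) else 0)"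
proof -
  have *: "\<exists>as bs. length as + length bs = length xs + length ys \<and>
           (\<forall>w. permute_list \<rho> (xs @ w # ys) = as @ w # bs)"
    if len: "length xs + Suc (length ys) = n" for xs ys :: "'a list"
  proof -
    have "length xs \<in> \<rho> ` {..<n}"
      unfolding permutes_image[OF assms] using len by simp
    then obtain j where j: "j < n" "\<rho> j = length xs" by auto
    let ?p = "permute_list \<rho> (xs @ undefined # ys)"
    have "permute_list \<rho> (xs @ w # ys) = take j ?p @ w # drop (Suc j) ?p" for w
    proof (rule nth_equalityI)
      show "length (permute_list \<rho> (xs @ w # ys)) = length (take j ?p @ w # drop (Suc j) ?p)"
        using j len by simp
      fix i assume "i < length (permute_list \<rho> (xs @ w # ys))"
      then have i: "i < n" using len by simp
      have nth: "permute_list \<rho> (xs @ v # ys) ! i = (xs @ v # ys) ! \<rho> i" for v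
        using assms i len by (subst permute_list_nth) auto
      show "permute_list \<rho> (xs @ w # ys) ! i = (take j ?p @ w # drop (Suc j) ?p) ! i"
      proof (cases "i = j")
        case True
        then show ?thesis using j len nth[of w] by (simp add: nth_append)
      next
        case False
        then have "\<rho> i \<noteq> length xs"
          using j permutes_inj[OF assms] by (metis injD)
        then have "(xs @ w # ys) ! \<rho> i = (xs @ undefined # ys) ! \<rho> i"
          by (simp add: nth_append nth_Cons split: nat.split)
        moreover have "(take j ?p @ w # drop (Suc j) ?p) ! i = ?p ! i"
          using False i j len
          by (auto simp: nth_append nth_Cons min_def split: nat.split intro: arg_cong[where f = "(!) ?p"])
        ultimately show ?thesis using nth by simp
      qed
    qed
    moreover have "length (take j ?p) + length (drop (Suc j) ?p) = length xs + length ys"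
      using j len by simp
    ultimately show ?thesis by blast
  qed
  show ?thesis
    unfolding multilinear_def
  proof (intro conjI allI)
    fix xs ys :: "'a list" and u v :: 'a and c :: real
    let ?f = "\<lambda>xs :: 'a list. if length xs = n then pure_tensor (permute_list \<rho> xs) else 0"
    show "?f (xs @ (u + v) # ys) = ?f (xs @ u # ys) + ?f (xs @ v # ys)"
      using *[of xs ys] by (auto simp: pure_tensor_add pure_tensor_scaleR)
    show "?f (xs @ (c *\<^sub>R u) # ys) = c *\<^sub>R ?f (xs @ u # ys)"
      using *[of xs ys] by (auto simp: pure_tensor_add pure_tensor_scaleR)
  qed
qed

lemma tensor_permute_pure:
  assumes "\<rho> permutes {..<length xs}"
  shows "tensor_permute (length xs) \<rho> (pure_tensor xs) = pure_tensor (permute_list \<rho> xs)"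
  unfolding tensor_permute_def by (simp add: tensor_lift_pure[OF multilinear_permute[OF assms]])

lemma multilinear_functional_prod:
  assumes "linear_on_power n \<phi>" "linear_on_power m \<sigma>"
  shows "multilinear (\<lambda>xs. if length xs = n + m
           then \<phi> (pure_tensor (take n xs)) * \<sigma> (pure_tensor (drop n xs)) else (0::real))"
proof -
  have mem: "pure_tensor xs \<in> tensor_power l" if "length xs = l" for xs :: "'a list" and l
    unfolding tensor_power_def by (rule span_base) (use that in auto)
  have lin: "A (pure_tensor (as @ (u + v) # bs))
        = A (pure_tensor (as @ u # bs)) + A (pure_tensor (as @ v # bs))"
    "A (pure_tensor (as @ (c *\<^sub>R u) # bs)) = c * A (pure_tensor (as @ u # bs))"
    if "linear_on_power l A" "length as + Suc (length bs) = l"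
    for l as bs and A :: "'a tensor \<Rightarrow> real" and u v :: 'a and c
    using that mem[of "as @ u # bs" l] mem[of "as @ v # bs" l]
    by (auto simp: pure_tensor_add pure_tensor_scaleR linear_on_power_def)
  let ?g = "\<lambda>xs. if length xs = n + m
           then \<phi> (pure_tensor (take n xs)) * \<sigma> (pure_tensor (drop n xs)) else (0::real)"
  have "?g (xs @ (u + v) # ys) = ?g (xs @ u # ys) + ?g (xs @ v # ys) \<and>
        ?g (xs @ (c *\<^sub>R u) # ys) = c *\<^sub>R ?g (xs @ u # ys)" for xs ys u v c
  proof (cases "length xs + Suc (length ys) = n + m")
    case True
    show ?thesis
    proof (cases "length xs < n")
      case less: True
      then obtain d where d: "n - length xs = Suc d" by (metis Suc_diff_Suc)
      have "length xs + Suc (length (take d ys)) = n" using d True by simp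
      then show ?thesis
        using True less d lin[OF assms(1), of xs "take d ys"] by (simp add: algebra_simps)
    next
      case False
      then have "length (drop n xs) + Suc (length ys) = m" using True by simp
      then show ?thesis
        using True False lin[OF assms(2), of "drop n xs" ys] by (simp add: algebra_simps)
    qed
  qed simp
  then show ?thesis unfolding multilinear_def by blast
qed

lemma functional_prod_pure:
  assumes "linear_on_power (length xs) \<phi>" "linear_on_power (length ys) \<sigma>"
  shows "functional_prod (length xs) (length ys) \<phi> \<sigma> (pure_tensor xs \<otimes>\<^sub>T pure_tensor ys)
           = \<phi> (pure_tensor xs) * \<sigma> (pure_tensor ys)"
  unfolding functional_prod_def
  by (simp add: tensor_prod_pure tensor_lift_pure[OF multilinear_functional_prod[OF assms]])


section \<open>Admissible norms\<close>

text \<open>In the following, \<open>\<nu> n\<close> is the norm of \<open>V\<^bsup>\<otimes>n\<^esup>\<close>; only its values on \<^term>\<open>tensor_power n\<close> matter.\<close>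

definition norm_on_power :: "nat \<Rightarrow> ('v::real_vector tensor \<Rightarrow> real) \<Rightarrow> bool" where
  "norm_on_power n N \<longleftrightarrow>
     (\<forall>t\<in>tensor_power n. 0 \<le> N t \<and> (N t = 0 \<longleftrightarrow> t = 0)) \<and>
     (\<forall>c. \<forall>t\<in>tensor_power n. N (c *\<^sub>R t) = \<bar>c\<bar> * N t) \<and>
     (\<forall>s\<in>tensor_power n. \<forall>t\<in>tensor_power n. N (s + t) \<le> N s + N t)"

definition bounded_linear_on_power ::
    "(nat \<Rightarrow> 'v::real_vector tensor \<Rightarrow> real) \<Rightarrow> nat \<Rightarrow> ('v tensor \<Rightarrow> 'w::real_normed_vector) \<Rightarrow> bool" where
  "bounded_linear_on_power \<nu> n A \<longleftrightarrow>
     linear_on_power n A \<and> (\<exists>C. \<forall>t\<in>tensor_power n. norm (A t) \<le> C * \<nu> n t)"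

text \<open>
  The operator norm, which is the dual norm for real-valued maps. The inserted \<open>0\<close> only matters
  if \<open>V\<^bsup>\<otimes>n\<^esup>\<close> is trivial and the supremum is over the empty set.
\<close>

definition op_norm ::
    "(nat \<Rightarrow> 'v::real_vector tensor \<Rightarrow> real) \<Rightarrow> nat \<Rightarrow> ('v tensor \<Rightarrow> 'w::real_normed_vector) \<Rightarrow> real" where
  "op_norm \<nu> n A = Sup (insert 0 {norm (A t) | t. t \<in> tensor_power n \<and> \<nu> n t = 1})"

definition admissible_norms :: "(nat \<Rightarrow> 'v::real_normed_vector tensor \<Rightarrow> real) \<Rightarrow> bool" where
  "admissible_norms \<nu> \<longleftrightarrow>
     (\<forall>n. norm_on_power n (\<nu> n)) \<and>
     (\<forall>c. \<nu> 0 (c *\<^sub>R pure_tensor []) = \<bar>c\<bar>) \<and>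
     (\<forall>v. \<nu> 1 (pure_tensor [v]) = norm v) \<and>
     (\<forall>n\<ge>1. \<forall>\<rho>. \<rho> permutes {..<n} \<longrightarrow>
        (\<forall>t\<in>tensor_power n. \<nu> n (tensor_permute n \<rho> t) = \<nu> n t)) \<and>
     (\<forall>n\<ge>1. \<forall>m\<ge>1. \<forall>s\<in>tensor_power n. \<forall>t\<in>tensor_power m.
        \<nu> (n + m) (s \<otimes>\<^sub>T t) \<le> \<nu> n s * \<nu> m t) \<and>
     (\<forall>n\<ge>1. \<forall>m\<ge>1. \<forall>(\<phi> :: 'v tensor \<Rightarrow> real) (\<sigma> :: 'v tensor \<Rightarrow> real).
        bounded_linear_on_power \<nu> n \<phi> \<and> bounded_linear_on_power \<nu> m \<sigma> \<longrightarrow>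
        bounded_linear_on_power \<nu> (n + m) (functional_prod n m \<phi> \<sigma>) \<and>
        op_norm \<nu> (n + m) (functional_prod n m \<phi> \<sigma>) \<le> op_norm \<nu> n \<phi> * op_norm \<nu> m \<sigma>)"


section \<open>Lipschitz functions in the sense of Stein\<close>

text \<open>
  \<open>\<L>(V\<^bsup>\<otimes>l\<^esup>; W)\<close>. For \<open>l = 0\<close>, the map \<open>A\<close> corresponds to the element \<open>A (pure_tensor [])\<close> of \<open>W\<close>.
\<close>

definition symmetric_forms ::
    "(nat \<Rightarrow> 'v::real_vector tensor \<Rightarrow> real) \<Rightarrow> nat \<Rightarrow> ('v tensor \<Rightarrow> 'w::real_normed_vector) set" where
  "symmetric_forms \<nu> l =
     {A. bounded_linear_on_power \<nu> l A \<and>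
         (\<forall>\<rho>. \<rho> permutes {..<l} \<longrightarrow> (\<forall>t\<in>tensor_power l. A (tensor_permute l \<rho> t) = A t))}"

text \<open>The \<open>k \<ge> 0\<close> with \<open>\<gamma> \<in> (k, k + 1]\<close>.\<close>

definition lip_order :: "real \<Rightarrow> nat" where
  "lip_order \<gamma> = nat (\<lceil>\<gamma>\<rceil> - 1)"

lemma lip_order_eq: "real k < \<gamma> \<Longrightarrow> \<gamma> \<le> real k + 1 \<Longrightarrow> lip_order \<gamma> = k"
proof -
  assume "real k < \<gamma>" "\<gamma> \<le> real k + 1"
  then have "\<lceil>\<gamma>\<rceil> = int k + 1" by (intro ceiling_unique) auto
  then show ?thesis by (simp add: lip_order_def)
qed

text \<open>
  A collection \<open>(\<psi>\<^sup>0, \<dots>, \<psi>\<^sup>k)\<close> is a function of the index \<open>l\<close>, the base point and the argument in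
  \<open>V\<^bsup>\<otimes>l\<^esup>\<close>; components of index beyond \<open>k\<close> and values at base points outside the domain are
  irrelevant.
\<close>

type_synonym ('v, 'w) lip_collection = "nat \<Rightarrow> 'v \<Rightarrow> 'v tensor \<Rightarrow> 'w"

definition lip_remainder ::
    "nat \<Rightarrow> ('v::real_vector, 'w::real_vector) lip_collection \<Rightarrow> nat \<Rightarrow> 'v \<Rightarrow> 'v \<Rightarrow> 'v tensor \<Rightarrow> 'w" where
  "lip_remainder k \<psi> l x y v =
     \<psi> l y v - (\<Sum>s=0..k-l. (1 / fact s) *\<^sub>R \<psi> (l + s) x (v \<otimes>\<^sub>T pure_tensor (replicate s (y - x))))"

definition lip_bounds ::
    "(nat \<Rightarrow> 'v::real_normed_vector tensor \<Rightarrow> real) \<Rightarrow> real \<Rightarrow> 'v set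
      \<Rightarrow> ('v, 'w::real_normed_vector) lip_collection \<Rightarrow> real set" where
  "lip_bounds \<nu> \<gamma> S \<psi> =
     {M. 0 \<le> M \<and>
        (\<forall>l\<le>lip_order \<gamma>. \<forall>x\<in>S. \<forall>y\<in>S.
           op_norm \<nu> l (\<psi> l x) \<le> M \<and>
           op_norm \<nu> l (lip_remainder (lip_order \<gamma>) \<psi> l x y) \<le> M * norm (y - x) powr (\<gamma> - real l))}"

definition Lip ::
    "(nat \<Rightarrow> 'v::real_normed_vector tensor \<Rightarrow> real) \<Rightarrow> real \<Rightarrow> 'v set
      \<Rightarrow> ('v, 'w::real_normed_vector) lip_collection set" where
  "Lip \<nu> \<gamma> S =
     {\<psi>. (\<forall>l\<le>lip_order \<gamma>. \<forall>x\<in>S. \<psi> l x \<in> symmetric_forms \<nu> l) \<and> lip_bounds \<nu> \<gamma> S \<psi> \<noteq> {}}"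

definition lip_norm ::
    "(nat \<Rightarrow> 'v::real_normed_vector tensor \<Rightarrow> real) \<Rightarrow> real \<Rightarrow> 'v set
      \<Rightarrow> ('v, 'w::real_normed_vector) lip_collection \<Rightarrow> real" where
  "lip_norm \<nu> \<gamma> S \<psi> = Inf (lip_bounds \<nu> \<gamma> S \<psi>)"

definition lip_truncate ::
    "nat \<Rightarrow> ('v, 'w::zero) lip_collection \<Rightarrow> ('v, 'w) lip_collection" where
  "lip_truncate q \<psi> = (\<lambda>l x v. if l \<le> q then \<psi> l x v else 0)"

definition lip_diff ::
    "('v, 'w::minus) lip_collection \<Rightarrow> ('v, 'w) lip_collection \<Rightarrow> ('v, 'w) lip_collection" where
  "lip_diff \<psi> \<phi> = (\<lambda>l x v. \<psi> l x v - \<phi> l x v)"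


section \<open>Sandwich constants and covering numbers\<close>

text \<open>
  The defining property of the constants \<open>\<delta>\<^sub>0\<close>, \<open>\<epsilon>\<^sub>0\<close> of the Lipschitz sandwich theorem, as a property
  of \<open>K = K\<^sub>1 + K\<^sub>2\<close> rather than of \<open>K\<^sub>1\<close> and \<open>K\<^sub>2\<close>. A bound on the norm of the difference includes
  its membership in the Lipschitz space.
\<close>

definition lip_sandwich_constants ::
    "'w::real_normed_vector itself \<Rightarrow> (nat \<Rightarrow> 'v::real_normed_vector tensor \<Rightarrow> real)
      \<Rightarrow> real \<Rightarrow> real \<Rightarrow> real \<Rightarrow> real \<Rightarrow> real \<Rightarrow> real \<Rightarrow> bool" where
  "lip_sandwich_constants (_ :: 'w itself) \<nu> \<epsilon> K \<gamma> \<eta> \<delta>\<^sub>0 \<epsilon>\<^sub>0 \<longleftrightarrow>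
     0 < \<delta>\<^sub>0 \<and> 0 < \<epsilon>\<^sub>0 \<and>
     (\<forall>K\<^sub>1 K\<^sub>2 S B. \<forall>\<psi>\<in>Lip \<nu> \<gamma> S. \<forall>(\<phi> :: ('v, 'w) lip_collection)\<in>Lip \<nu> \<gamma> S.
        0 \<le> K\<^sub>1 \<and> 0 \<le> K\<^sub>2 \<and> K\<^sub>1 + K\<^sub>2 = K \<and>
        closed S \<and> S \<noteq> {} \<and> closed B \<and> B \<subseteq> S \<and> S \<subseteq> (\<Union>x\<in>B. cball x \<delta>\<^sub>0) \<and>
        lip_norm \<nu> \<gamma> S \<psi> \<le> K\<^sub>1 \<and> lip_norm \<nu> \<gamma> S \<phi> \<le> K\<^sub>2 \<and>
        (\<forall>l\<le>lip_order \<gamma>. \<forall>x\<in>B. op_norm \<nu> l (lip_diff \<psi> \<phi> l x) \<le> \<epsilon>\<^sub>0) \<longrightarrow>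
        lip_diff (lip_truncate (lip_order \<eta>) \<psi>) (lip_truncate (lip_order \<eta>) \<phi>) \<in> Lip \<nu> \<eta> S \<and>
        lip_norm \<nu> \<eta> S
          (lip_diff (lip_truncate (lip_order \<eta>) \<psi>) (lip_truncate (lip_order \<eta>) \<phi>)) \<le> \<epsilon>)"

definition covering_number :: "real \<Rightarrow> 'v::metric_space set \<Rightarrow> nat" where
  "covering_number \<delta> S =
     (LEAST d. \<exists>x :: nat \<Rightarrow> 'v. x ` {1..d} \<subseteq> S \<and> S \<subseteq> (\<Union>j\<in>{1..d}. cball (x j) \<delta>))"

end

theory Submission
  imports Defs
begin

text \<open>The points are the centres of a cover of \<open>S\<close> by the least possible number
  of closed balls of radius \<open>\<delta>\<^sub>0\<close>. A compact set is closed and has a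
  finite such cover, so the minimum in the definition of \<open>covering_number\<close> is attained
  (\<open>covering_number_attained\<close>). The set of centres is finite, hence closed, and can
  serve as the set \<open>B\<close> in the sandwich property; closeness of the two collections at
  the centres is then what that property asks for on \<open>B\<close>. Empty \<open>S\<close> is
  outside its scope and is settled directly with \<open>Lip_empty\<close> and
  \<open>lip_norm_empty\<close>.\<close>

lemma covering_number_attained:
  fixes S :: "'v::metric_space set"
  assumes "compact S" "0 < \<delta>"
  shows "\<exists>x :: nat \<Rightarrow> 'v. x ` {1..covering_number \<delta> S} \<subseteq> S \<and>
           S \<subseteq> (\<Union>j\<in>{1..covering_number \<delta> S}. cball (x j) \<delta>)"
proof -
  \<comment> \<open>Compactness needs open balls; they are enlarged to closed ones below.\<close>
  obtain F where F: "finite F" "F \<subseteq> S" "S \<subseteq> (\<Union>x\<in>F. ball x \<delta>)"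
  proof (rule compactE_image[OF assms(1), of S "\<lambda>x. ball x \<delta>"])
    show "S \<subseteq> (\<Union>x\<in>S. ball x \<delta>)"
      using assms(2) by (meson UN_I centre_in_ball subsetI)
  qed auto
  obtain x where "bij_betw x {1..card F} F"
    using ex_bij_betw_nat_finite_1[OF F(1)] by blast
  then have x: "x ` {1..card F} = F"
    by (rule bij_betw_imp_surj_on)
  have "S \<subseteq> (\<Union>y\<in>x ` {1..card F}. cball y \<delta>)"
    unfolding x by (rule subset_trans[OF F(3) UN_mono]) auto
  then have "S \<subseteq> (\<Union>j\<in>{1..card F}. cball (x j) \<delta>)"
    by simp
  moreover have "x ` {1..card F} \<subseteq> S"
    using x F(2) by simp
  \<comment> \<open>Some number of balls suffices, so the \<open>LEAST\<close> operator returns a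
    number that suffices too.\<close>
  ultimately have "\<exists>(d::nat) x. x ` {1..d} \<subseteq> S \<and> S \<subseteq> (\<Union>j\<in>{1..d}. cball (x j) \<delta>)"
    by blast
  then show ?thesis
    unfolding covering_number_def by (rule LeastI_ex)
qed

text \<open>Over an empty domain every condition on a bound is vacuous except nonnegativity. Hence
  any collection is Lipschitz there, with norm \<open>Inf {0..} = 0\<close>.\<close>

lemma lip_bounds_empty: "lip_bounds \<nu> \<gamma> {} \<psi> = {0..}"
  by (auto simp: lip_bounds_def)

lemma Lip_empty: "\<psi> \<in> Lip \<nu> \<gamma> {}"
  by (simp add: Lip_def lip_bounds_empty)

lemma lip_norm_empty: "lip_norm \<nu> \<gamma> {} \<psi> = 0"
  by (simp add: lip_norm_def lip_bounds_empty)

theorem corollary4p1: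
  fixes \<nu> :: "nat \<Rightarrow> 'v::banach tensor \<Rightarrow> real"
    and S :: "'v set"
    and \<epsilon> K\<^sub>1 K\<^sub>2 \<gamma> \<eta> \<delta>\<^sub>0 \<epsilon>\<^sub>0 :: real
    and k q N :: nat
  assumes "admissible_norms \<nu>"
    and "compact S"
    and "0 < \<epsilon>"
    and "0 \<le> K\<^sub>1" and "0 \<le> K\<^sub>2" and "(K\<^sub>1, K\<^sub>2) \<noteq> (0, 0)"
    and "0 < \<eta>" and "\<eta> < \<gamma>"
    and "\<gamma> \<in> {real k<..real k + 1}"
    and "\<eta> \<in> {real q<..real q + 1}"
    and "lip_sandwich_constants TYPE('w::banach) \<nu> \<epsilon> (K\<^sub>1 + K\<^sub>2) \<gamma> \<eta> \<delta>\<^sub>0 \<epsilon>\<^sub>0"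
    and "N = covering_number \<delta>\<^sub>0 S"
  shows "\<exists>z :: nat \<Rightarrow> 'v. z ` {1..N} \<subseteq> S \<and>
    (\<forall>\<psi> \<phi> :: ('v, 'w) lip_collection.
       \<psi> \<in> Lip \<nu> \<gamma> S \<and> \<phi> \<in> Lip \<nu> \<gamma> S \<and>
       lip_norm \<nu> \<gamma> S \<psi> \<le> K\<^sub>1 \<and> lip_norm \<nu> \<gamma> S \<phi> \<le> K\<^sub>2 \<and>
       (\<forall>l\<in>{0..k}. \<forall>j\<in>{1..N}. op_norm \<nu> l (lip_diff \<psi> \<phi> l (z j)) \<le> \<epsilon>\<^sub>0) \<longrightarrow>
       lip_diff (lip_truncate q \<psi>) (lip_truncate q \<phi>) \<in> Lip \<nu> \<eta> S \<and>
       lip_norm \<nu> \<eta> S (lip_diff (lip_truncate q \<psi>) (lip_truncate q \<phi>)) \<le> \<epsilon>)"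
proof -
  have pos: "0 < \<delta>\<^sub>0"
    using assms(11) by (simp add: lip_sandwich_constants_def)
  have ord: "lip_order \<gamma> = k" "lip_order \<eta> = q"
    using assms(9,10) by (auto intro: lip_order_eq)
  \<comment> \<open>The centres depend only on \<open>S\<close> and \<open>\<delta>\<^sub>0\<close>.
    They are fixed before \<open>\<psi>\<close> and \<open>\<phi>\<close>, so one choice serves all
    pairs.\<close>
  obtain z :: "nat \<Rightarrow> 'v" where z: "z ` {1..N} \<subseteq> S" "S \<subseteq> (\<Union>j\<in>{1..N}. cball (z j) \<delta>\<^sub>0)"
    using covering_number_attained[OF assms(2) pos] assms(12) by blast
  have "lip_diff (lip_truncate q \<psi>) (lip_truncate q \<phi>) \<in> Lip \<nu> \<eta> S \<and>
        lip_norm \<nu> \<eta> S (lip_diff (lip_truncate q \<psi>) (lip_truncate q \<phi>)) \<le> \<epsilon>"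
    if L: "\<psi> \<in> Lip \<nu> \<gamma> S" "\<phi> \<in> Lip \<nu> \<gamma> S"
      and K: "lip_norm \<nu> \<gamma> S \<psi> \<le> K\<^sub>1" "lip_norm \<nu> \<gamma> S \<phi> \<le> K\<^sub>2"
      and near: "\<forall>l\<in>{0..k}. \<forall>j\<in>{1..N}. op_norm \<nu> l (lip_diff \<psi> \<phi> l (z j)) \<le> \<epsilon>\<^sub>0"
    for \<psi> \<phi> :: "('v, 'w) lip_collection"
  proof (cases "S = {}")
    \<comment> \<open>The sandwich property only speaks about non-empty sets.\<close>
    case True
    then show ?thesis
      using assms(3) by (simp add: Lip_empty lip_norm_empty)
  next
    case False
    let ?B = "z ` {1..N}"
    have "closed S" "closed ?B" "S \<subseteq> (\<Union>x\<in>?B. cball x \<delta>\<^sub>0)"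
      using compact_imp_closed[OF assms(2)] z(2) by (simp_all add: finite_imp_closed)
    moreover have "\<forall>l\<le>lip_order \<gamma>. \<forall>x\<in>?B. op_norm \<nu> l (lip_diff \<psi> \<phi> l x) \<le> \<epsilon>\<^sub>0"
      using near by (simp add: ord)
    \<comment> \<open>The sandwich property covers every splitting of
      \<open>K\<^sub>1 + K\<^sub>2\<close> into nonnegative summands; it is applied to the given
      one. Rewriting with \<open>ord\<close> turns its \<open>lip_order\<close> into
      \<open>k\<close> and \<open>q\<close>.\<close>
    ultimately show ?thesis
      using assms(11)[unfolded lip_sandwich_constants_def, THEN conjunct2, THEN conjunct2,
          rule_format, OF L, of K\<^sub>1 K\<^sub>2 ?B]
        assms(4,5) z(1) K False
      unfolding ord by simp
  qed
  then show ?thesis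
    using z(1) by blast
qed

end
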